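(* Let $d \ge 2$ and $\alpha_1,\dots,\alpha_d \in (0,1)$ be fixed. For each $n$, let $A_1,\dots,A_d \subseteq \{1,\dots,n\}$ be independent random sets, where each $m \in \{1,\dots,n\}$ belongs to $A_i$ independently with probability $\alpha_i$. Let $\mathrm{visible}(A_1 \times \cdots \times A_d)$ be the set of points $P \in A_1 \times\cdots\times A_d$ such that the line segment from the origin to $P$ contains no point of $A_1\times\cdots\times A_d$ other than $P$. Then, with probability $1-o(1)$ as $n\to\infty$, $$|\mathrm{visible}(A_1\times\cdots\times A_d)| \sim \mu(\alpha_1,\dots,\alpha_d)\, n^d,$$ i.e. for every $\varepsilon>0$ the probability that $\left|\frac{|\mathrm{visible}(A_1\times\cdots\times A_d)|}{\mu(\alpha_1,\dots,\alpha_d)n^d}-1\right|>\varepsilon$ tends to $0$, where $$\mu(\alpha_1,\dots,\alpha_d) = \frac{\alpha_1\cdots\alpha_d}{\zeta(d)} \frac{\operatorname{Li}_d(1-\alpha_1\cdots\alpha_d)}{1-\alpha_1\cdots\alpha_d}, \qquad \operatorname{Li}_d(z) = \sum_{k\ge1}\frac{z^k}{k^d}.$$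
   Context: $\zeta$ is the Riemann zeta function and $\operatorname{Li}_d$ is the polylogarithm of order $d$. *)

theory Defs
  imports "HOL-Probability.Probability"
begin

(* The Riemann zeta function at a natural argument, via its Dirichlet series;
   the series represents zeta only for s >= 2, the only arguments used. *)
definition zeta_nat :: "nat \<Rightarrow> real" where
  "zeta_nat s = (\<Sum>k. 1 / real (Suc k) ^ s)"

(* The terms are shifted by one: index k stands for the summand k + 1.
   Only meaningful where the series converges, in particular for |z| < 1. *)
definition polylog :: "nat \<Rightarrow> real \<Rightarrow> real" where
  "polylog d z = (\<Sum>k. z ^ Suc k / real (Suc k) ^ d)"

(* The Cartesian product of the sets A i, embedded in Euclidean space so that
   line segments make sense; the index type plays the role of {1, ..., d}. *)
definition lattice_product :: "('d \<Rightarrow> nat set) \<Rightarrow> (real ^ 'd) set" where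
  "lattice_product A = {P. \<forall>i. P $ i \<in> real ` A i}"

definition visible :: "(real ^ 'd) set \<Rightarrow> (real ^ 'd) set" where
  "visible S = {P \<in> S. \<forall>Q \<in> closed_segment 0 P. Q \<in> S \<longrightarrow> Q = P}"

definition visible_density :: "('d::finite \<Rightarrow> real) \<Rightarrow> real" where
  "visible_density \<alpha> =
     (\<Prod>i\<in>UNIV. \<alpha> i) / zeta_nat CARD('d) *
     (polylog CARD('d) (1 - (\<Prod>i\<in>UNIV. \<alpha> i)) / (1 - (\<Prod>i\<in>UNIV. \<alpha> i)))"

end

theory Submission
  imports Defs
begin

text \<open>Each visible point is the first point of the random product on the ray through a primitive vector \<open>v\<close>,
  so the number of visible points is a sum of indicators over the primitive \<open>v\<close> in \<open>{1..n}\<^sup>d\<close>. The multiples of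
  \<open>v\<close> lie in the product independently with probability \<open>p = \<alpha>\<^sub>1 \<cdots> \<alpha>\<^sub>d\<close>, so the ray of \<open>v\<close> is hit with
  probability \<open>1 - (1 - p)\<^sup>m\<close>, where \<open>m\<close> is the number of multiples of \<open>v\<close> in the grid. Expanding this as a
  geometric sum gives the mean \<open>\<Sum>k. p (1 - p)^(k - 1) N(n div k)\<close> with \<open>N(m) \<sim> m\<^sup>d / \<zeta>(d)\<close> the number of primitive
  vectors. Two rays are dependent only if they have multiples sharing a coordinate, so there are at most
  \<open>d n^(2 d - 1)\<close> dependent pairs, and Chebyshev's inequality gives concentration.\<close>

subsection \<open>Independence and second moments\<close>

context prob_space
begin

text \<open>A Boolean variable generates the same sigma-algebra as the single event that it is true.
  A one-element family is closed under intersection, so independence of the events extends to the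
  generated sigma-algebras.\<close>

lemma indep_vars_bool:
  fixes X :: "'i \<Rightarrow> 'a \<Rightarrow> bool"
  assumes "indep_events (\<lambda>i. {\<omega> \<in> space M. X i \<omega>}) I"
  shows "indep_vars (\<lambda>_. count_space UNIV) X I"
proof -
  have ev: "{\<omega> \<in> space M. X i \<omega>} \<in> events" if "i \<in> I" for i
    using assms that by (auto simp: indep_events_def)
  have "indep_sets (\<lambda>i. sigma_sets (space M) {{\<omega> \<in> space M. X i \<omega>}}) I"
    using assms by (intro indep_sets_sigma) (auto simp: indep_events_def_alt Int_stable_def)
  moreover have "{X i -` B \<inter> space M | B. B \<in> sets (count_space UNIV)}
      \<subseteq> sigma_sets (space M) {{\<omega> \<in> space M. X i \<omega>}}" for i
  proof clarify
    fix B :: "bool set"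
    let ?E = "{\<omega> \<in> space M. X i \<omega>}"
    have "X i -` B \<inter> space M \<in> {{}, space M, ?E, space M - ?E}"
    proof -
      have "B \<in> {{}, {True}, {False}, UNIV}"
        using Pow_UNIV[where ?'a = bool] by (auto simp: UNIV_bool Pow_insert)
      then show ?thesis by auto
    qed
    then show "X i -` B \<inter> space M \<in> sigma_sets (space M) {?E}"
      by (metis (no_types, lifting) emptyE insertE insertI1 sigma_sets.Basic sigma_sets.Compl sigma_sets.Empty sigma_sets_top)
  qed
  ultimately have "indep_sets (\<lambda>i. {X i -` B \<inter> space M | B. B \<in> sets (count_space UNIV)}) I"
    by (rule indep_sets_mono_sets)
  moreover have "X i \<in> measurable M (count_space UNIV)" if "i \<in> I" for i
    using ev[OF that] by (simp add: pred_def)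
  ultimately show ?thesis
    by (auto simp: indep_vars_def2)
qed

text \<open>Independence between the random sets and independence of the memberships inside each set
  combine to joint independence over all pairs \<open>(i, m)\<close>. A finite set of pairs is cut
  into slices by \<open>i\<close>: the first hypothesis factors the probability over the slices, the
  second factors each slice over its elements.\<close>

lemma indep_vars_random_sets_mem:
  fixes A :: "'d::finite \<Rightarrow> 'a \<Rightarrow> 'b set"
  assumes iv: "indep_vars (\<lambda>i. count_space (Pow B)) A UNIV"
    and ie: "\<And>i. indep_events (\<lambda>m. {\<omega> \<in> space M. m \<in> A i \<omega>}) B"
  shows "indep_vars (\<lambda>_. count_space UNIV) (\<lambda>(i, m) \<omega>. m \<in> A i \<omega>) (UNIV \<times> B)"
proof (rule indep_vars_bool, rule indep_eventsI)
  fix x :: "'d \<times> 'b" assume "x \<in> UNIV \<times> B"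
  then show "{\<omega> \<in> space M. (case x of (i, m) \<Rightarrow> \<lambda>\<omega>. m \<in> A i \<omega>) \<omega>} \<in> events"
    using ie by (auto simp: indep_events_def)
next
  fix J :: "('d \<times> 'b) set" assume J: "J \<subseteq> UNIV \<times> B" "finite J" "J \<noteq> {}"
  define L where "L i = {m. (i, m) \<in> J}" for i
  have L: "finite (L i)" "L i \<subseteq> B" for i
    using J finite_subset[of "L i" "snd ` J"] by (force simp: L_def)+
  have sp: "A i \<omega> \<subseteq> B" if "\<omega> \<in> space M" for i \<omega>
    using iv that measurable_space[of "A i" M "count_space (Pow B)" \<omega>] by (auto simp: indep_vars_def2)
  have JL: "J = Sigma UNIV L" by (auto simp: L_def)
  have "(\<Inter>x\<in>J. {\<omega> \<in> space M. (case x of (i, m) \<Rightarrow> \<lambda>\<omega>. m \<in> A i \<omega>) \<omega>})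
      = (\<Inter>i\<in>UNIV. A i -` {C \<in> Pow B. L i \<subseteq> C} \<inter> space M)"
    using J(3) sp by (auto simp: L_def)
  also have "prob \<dots> = (\<Prod>i\<in>UNIV. prob (A i -` {C \<in> Pow B. L i \<subseteq> C} \<inter> space M))"
    by (rule indep_varsD[OF iv]) auto
  also have "\<dots> = (\<Prod>i\<in>UNIV. \<Prod>m\<in>L i. prob {\<omega> \<in> space M. m \<in> A i \<omega>})"
  proof (rule prod.cong[OF refl])
    fix i :: 'd
    show "prob (A i -` {C \<in> Pow B. L i \<subseteq> C} \<inter> space M)
        = (\<Prod>m\<in>L i. prob {\<omega> \<in> space M. m \<in> A i \<omega>})"
    \<comment> \<open>\<open>indep_events\<close> gives a product formula only for nonempty index
      sets; an empty slice contributes the whole space and an empty product.\<close>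
    proof (cases "L i = {}")
      case True
      then have "A i -` {C \<in> Pow B. L i \<subseteq> C} \<inter> space M = space M" using sp by auto
      then show ?thesis using True by (simp add: prob_space)
    next
      case False
      then have "A i -` {C \<in> Pow B. L i \<subseteq> C} \<inter> space M = (\<Inter>m\<in>L i. {\<omega> \<in> space M. m \<in> A i \<omega>})"
        using sp by auto
      with ie[of i] False L show ?thesis by (simp add: indep_events_def)
    qed
  qed
  also have "\<dots> = (\<Prod>(i, m)\<in>J. prob {\<omega> \<in> space M. m \<in> A i \<omega>})"
    using L by (subst JL, subst prod.Sigma) auto
  finally show "prob (\<Inter>x\<in>J. {\<omega> \<in> space M. (case x of (i, m) \<Rightarrow> \<lambda>\<omega>. m \<in> A i \<omega>) \<omega>})
      = (\<Prod>x\<in>J. prob {\<omega> \<in> space M. (case x of (i, m) \<Rightarrow> \<lambda>\<omega>. m \<in> A i \<omega>) \<omega>})"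
    by (simp add: case_prod_beta)
qed

text \<open>Functions of disjoint blocks of independent variables are independent, and a single
  block is completely true with the product of its probabilities. Later each block collects the
  memberships that place one multiple of a fixed vector in the random product.\<close>

lemma prob_none_of_blocks:
  fixes X :: "'i \<Rightarrow> 'a \<Rightarrow> bool"
  assumes ind: "indep_vars (\<lambda>_. count_space UNIV) X I"
    and J: "finite J" and K: "\<And>j. j \<in> J \<Longrightarrow> finite (K j) \<and> K j \<noteq> {} \<and> K j \<subseteq> I"
    and disj: "disjoint_family_on K J"
  shows "prob {\<omega> \<in> space M. \<forall>j\<in>J. \<not> (\<forall>i\<in>K j. X i \<omega>)}
    = (\<Prod>j\<in>J. 1 - (\<Prod>i\<in>K j. prob {\<omega> \<in> space M. X i \<omega>}))"
proof (cases "J = {}")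
  case True
  then show ?thesis by (simp add: prob_space)
next
  case False
  define Y where "Y j \<omega> \<longleftrightarrow> (\<forall>i\<in>K j. X i \<omega>)" for j \<omega>
  have "indep_vars (\<lambda>j. count_space (UNIV::bool set))
      (\<lambda>j \<omega>. (\<lambda>x. \<forall>i\<in>K j. x i) (restrict (\<lambda>i. X i \<omega>) (K j))) J"
  proof (rule indep_vars_compose2[OF indep_vars_restrict[OF ind _ disj]])
    fix j assume "j \<in> J"
    then have "finite (K j)" using K by auto
    then show "(\<lambda>x. \<forall>i\<in>K j. x i) \<in> measurable (PiM (K j) (\<lambda>_. count_space (UNIV::bool set))) (count_space UNIV)"
      by measurable
  qed (use K in auto)
  then have iY: "indep_vars (\<lambda>j. count_space UNIV) Y J"
    by (simp add: Y_def[abs_def])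
  have PY: "prob {\<omega> \<in> space M. \<not> Y j \<omega>} = 1 - (\<Prod>i\<in>K j. prob {\<omega> \<in> space M. X i \<omega>})"
    if j: "j \<in> J" for j
  proof -
    have Ym: "Y j \<in> measurable M (count_space UNIV)" using iY j by (auto simp: indep_vars_def2)
    then have "{\<omega> \<in> space M. Y j \<omega>} \<in> events" by (simp add: pred_def)
    then have "prob {\<omega> \<in> space M. \<not> Y j \<omega>} = 1 - prob {\<omega> \<in> space M. Y j \<omega>}"
      by (subst prob_compl[symmetric]) (auto intro: arg_cong[where f=prob])
    also have "{\<omega> \<in> space M. Y j \<omega>} = (\<Inter>i\<in>K j. X i -` {True} \<inter> space M)"
      using K[OF j] by (auto simp: Y_def)
    also have "prob \<dots> = (\<Prod>i\<in>K j. prob (X i -` {True} \<inter> space M))"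
      using K[OF j] by (intro indep_varsD[OF ind]) auto
    also have "\<dots> = (\<Prod>i\<in>K j. prob {\<omega> \<in> space M. X i \<omega>})"
      by (intro prod.cong refl arg_cong[where f=prob]) auto
    finally show ?thesis .
  qed
  have vim: "Y j -` {False} \<inter> space M = {\<omega> \<in> space M. \<not> Y j \<omega>}" for j
    by auto
  have "{\<omega> \<in> space M. \<forall>j\<in>J. \<not> (\<forall>i\<in>K j. X i \<omega>)} = (\<Inter>j\<in>J. Y j -` {False} \<inter> space M)"
    using False unfolding vim unfolding Y_def by blast
  also have "prob \<dots> = (\<Prod>j\<in>J. prob (Y j -` {False} \<inter> space M))"
    using J False by (intro indep_varsD_finite[OF iY]) auto
  also have "\<dots> = (\<Prod>j\<in>J. prob {\<omega> \<in> space M. \<not> Y j \<omega>})"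
    by (simp only: vim)
  finally show ?thesis using PY by simp
qed

text \<open>The case of two blocks with arbitrary measurable predicates. It serves for two rays,
  whose predicates are disjunctions over multiples.\<close>

lemma prob_conj_disjoint_blocks:
  fixes X :: "'i \<Rightarrow> 'a \<Rightarrow> bool"
  assumes ind: "indep_vars (\<lambda>_. count_space UNIV) X I"
    and AB: "A \<inter> B = {}" "A \<subseteq> I" "B \<subseteq> I"
    and f: "f \<in> measurable (PiM A (\<lambda>_. count_space UNIV)) (count_space UNIV)"
    and g: "g \<in> measurable (PiM B (\<lambda>_. count_space UNIV)) (count_space UNIV)"
  shows "prob {\<omega> \<in> space M. f (restrict (\<lambda>i. X i \<omega>) A) \<and> g (restrict (\<lambda>i. X i \<omega>) B)}
    = prob {\<omega> \<in> space M. f (restrict (\<lambda>i. X i \<omega>) A)} * prob {\<omega> \<in> space M. g (restrict (\<lambda>i. X i \<omega>) B)}"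
proof -
  have "indep_var (count_space UNIV) (f \<circ> (\<lambda>\<omega>. restrict (\<lambda>i. X i \<omega>) A))
     (count_space UNIV) (g \<circ> (\<lambda>\<omega>. restrict (\<lambda>i. X i \<omega>) B))"
    by (rule indep_var_compose[OF indep_var_restrict[OF ind AB] f g])
  from indep_varD[OF this, of "{True}" "{True}"]
  show ?thesis by (simp add: vimage_def Int_def conj_commute)
qed

lemma expectation_sum_indicator:
  assumes R: "finite R" and F: "\<And>v. v \<in> R \<Longrightarrow> F v \<in> events"
  shows "expectation (\<lambda>\<omega>. \<Sum>v\<in>R. indicator (F v) \<omega>) = (\<Sum>v\<in>R. prob (F v))"
  using F by (subst Bochner_Integration.integral_sum)
    (auto intro!: integrable_real_indicator simp: emeasure_eq_measure)

text \<open>The variance expands into covariances over all pairs. Pairs outside \<open>D\<close>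
  contribute 0, and every other covariance is at most 1. The diagonal is included:
  \<open>(v, v)\<close> may lie outside \<open>D\<close> only if \<open>prob (F v)\<close> equals
  its own square.\<close>

lemma variance_sum_indicator_le:
  assumes R: "finite R" and F: "\<And>v. v \<in> R \<Longrightarrow> F v \<in> events"
    and ind: "\<And>v w. v \<in> R \<Longrightarrow> w \<in> R \<Longrightarrow> (v, w) \<notin> D \<Longrightarrow> prob (F v \<inter> F w) = prob (F v) * prob (F w)"
  shows "variance (\<lambda>\<omega>. \<Sum>v\<in>R. indicator (F v) \<omega>) \<le> card (D \<inter> R \<times> R)"
proof -
  let ?Z = "\<lambda>v \<omega>. indicator (F v) \<omega> - prob (F v)"
  have eq: "?Z v \<omega> * ?Z w \<omega> = indicator (F v \<inter> F w) \<omega> - prob (F w) * indicator (F v) \<omega>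
      - prob (F v) * indicator (F w) \<omega> + prob (F v) * prob (F w)" for v w \<omega>
    by (simp add: indicator_inter_arith algebra_simps)
  have ind_int: "integrable M (indicator (F v) :: _ \<Rightarrow> real)"
    "integrable M (indicator (F v \<inter> F w) :: _ \<Rightarrow> real)" if "v \<in> R" "w \<in> R" for v w
    using F that by (auto intro!: integrable_real_indicator simp: emeasure_eq_measure)
  have int: "integrable M (\<lambda>\<omega>. ?Z v \<omega> * ?Z w \<omega>)" if "v \<in> R" "w \<in> R" for v w
    unfolding eq using ind_int that by auto
  have cov: "expectation (\<lambda>\<omega>. ?Z v \<omega> * ?Z w \<omega>) = prob (F v \<inter> F w) - prob (F v) * prob (F w)"
    if "v \<in> R" "w \<in> R" for v w
    unfolding eq using ind_int that F by (simp add: prob_space)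
  have "variance (\<lambda>\<omega>. \<Sum>v\<in>R. indicator (F v) \<omega>) = expectation (\<lambda>\<omega>. (\<Sum>v\<in>R. ?Z v \<omega>)\<^sup>2)"
    using R F by (subst expectation_sum_indicator) (auto simp: sum_subtractf)
  also have "\<dots> = expectation (\<lambda>\<omega>. \<Sum>x\<in>R\<times>R. ?Z (fst x) \<omega> * ?Z (snd x) \<omega>)"
    by (simp add: power2_eq_square sum_product sum.cartesian_product case_prod_beta)
  also have "\<dots> = (\<Sum>x\<in>R\<times>R. expectation (\<lambda>\<omega>. ?Z (fst x) \<omega> * ?Z (snd x) \<omega>))"
    using int by (intro Bochner_Integration.integral_sum) auto
  also have "\<dots> = (\<Sum>(v, w)\<in>R\<times>R. prob (F v \<inter> F w) - prob (F v) * prob (F w))"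
    using cov by (intro sum.cong) auto
  also have "\<dots> \<le> (\<Sum>x\<in>R\<times>R. indicator D x)"
  proof (intro sum_mono, clarify)
    fix v w assume "v \<in> R" "w \<in> R"
    moreover have "prob (F v \<inter> F w) - prob (F v) * prob (F w) \<le> 1"
      using prob_le_1[of "F v \<inter> F w"] by (smt (verit) measure_nonneg mult_nonneg_nonneg)
    ultimately show "prob (F v \<inter> F w) - prob (F v) * prob (F w) \<le> indicator D (v, w)"
      using ind by (auto simp: indicator_def)
  qed
  also have "\<dots> = card (D \<inter> R \<times> R)"
    using R by (simp add: indicator_def Int_commute flip: of_bool_def sum_mult_indicator)
  finally show ?thesis .
qed

lemma prob_sum_indicator_deviation_le:
  assumes R: "finite R" and F: "\<And>v. v \<in> R \<Longrightarrow> F v \<in> events"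
    and ind: "\<And>v w. v \<in> R \<Longrightarrow> w \<in> R \<Longrightarrow> (v, w) \<notin> D \<Longrightarrow> prob (F v \<inter> F w) = prob (F v) * prob (F w)"
    and a: "a > 0"
  shows "prob {\<omega> \<in> space M. \<bar>(\<Sum>v\<in>R. indicator (F v) \<omega>) - (\<Sum>v\<in>R. prob (F v))\<bar> \<ge> a}
    \<le> card (D \<inter> R \<times> R) / a\<^sup>2"
proof -
  let ?f = "\<lambda>\<omega>. \<Sum>v\<in>R. indicator (F v) \<omega> :: real"
  have rv: "random_variable borel ?f"
    using F by measurable
  have "integrable M (\<lambda>\<omega>. (?f \<omega>)\<^sup>2)"
  proof (rule integrable_const_bound[where B="(real (card R))\<^sup>2"])
    show "AE \<omega> in M. norm ((?f \<omega>)\<^sup>2) \<le> (real (card R))\<^sup>2"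
      by (auto intro!: AE_I2 power_mono sum_nonneg sum_bounded_above[of R _ 1, simplified] indicator_le_1)
  qed (use rv in measurable)
  from Chebyshev_inequality[OF rv this a]
  have "prob {\<omega> \<in> space M. \<bar>?f \<omega> - expectation ?f\<bar> \<ge> a} \<le> variance ?f / a\<^sup>2" .
  also have "\<dots> \<le> card (D \<inter> R \<times> R) / a\<^sup>2"
    by (intro divide_right_mono variance_sum_indicator_le assms) auto
  finally show ?thesis
    using expectation_sum_indicator[OF R F] by simp
qed

end

subsection \<open>Counting primitive vectors\<close>

text \<open>Coordinates start at 1, as in the sets \<open>A i\<close>, so gcds and maxima of grid
  points are positive.\<close>

definition grid :: "nat \<Rightarrow> ('d \<Rightarrow> nat) set" where
  "grid n = UNIV \<rightarrow> {1..n}"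

definition primitive_part :: "('d \<Rightarrow> nat) \<Rightarrow> 'd \<Rightarrow> nat" where
  "primitive_part x = (\<lambda>i. x i div Gcd (range x))"

definition primitive_grid :: "nat \<Rightarrow> ('d \<Rightarrow> nat) set" where
  "primitive_grid n = {v \<in> grid n. Gcd (range v) = 1}"

lemma finite_grid [simp, intro]: "finite (grid n :: ('d::finite \<Rightarrow> nat) set)"
  unfolding grid_def by (metis PiE_UNIV_domain finite finite_PiE finite_atLeastAtMost)

lemma card_grid: "card (grid n :: ('d::finite \<Rightarrow> nat) set) = n ^ CARD('d)"
  unfolding grid_def by (simp flip: PiE_UNIV_domain add: card_PiE)

lemma finite_primitive_grid [simp, intro]: "finite (primitive_grid n :: ('d::finite \<Rightarrow> nat) set)"
  by (simp add: primitive_grid_def)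

lemma scale_in_grid_iff:
  assumes "k > 0"
  shows "(\<lambda>i. k * v i) \<in> grid n \<longleftrightarrow> v \<in> grid (n div k)"
  using assms by (auto simp: grid_def Pi_iff less_eq_div_iff_mult_less_eq mult.commute Suc_le_eq)

lemma Gcd_range_scale: "Gcd (range (\<lambda>i. k * v i)) = k * Gcd (range v)" for k :: nat
  using Gcd_mult[of k "range v"] by (simp add: image_image)

lemma Gcd_range_dvd: "Gcd (range x) dvd x i" for x :: "'d \<Rightarrow> nat"
  by (rule Gcd_dvd) simp

lemma scale_primitive_part: "Gcd (range x) * primitive_part x i = x i"
  using Gcd_range_dvd[of x i] by (simp add: primitive_part_def)

lemma Gcd_range_pos:
  assumes "x \<in> grid n"
  shows "Gcd (range x) > 0"
  using assms Gcd_range_dvd[of x] by (force simp: grid_def Pi_iff intro!: Nat.gr0I)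

lemma Gcd_range_primitive_part:
  assumes "x \<in> grid n"
  shows "Gcd (range (primitive_part x)) = 1"
proof -
  have "Gcd (range x) = Gcd (range x) * Gcd (range (primitive_part x))"
    unfolding Gcd_range_scale[symmetric] scale_primitive_part ..
  then show ?thesis
    using Gcd_range_pos[OF assms] by (metis mult_cancel1 mult.right_neutral less_numeral_extra(3))
qed

lemma primitive_part_scale:
  assumes "Gcd (range v) = 1" "k > 0"
  shows "primitive_part (\<lambda>i. k * v i) = v"
  using assms by (simp add: primitive_part_def Gcd_range_scale)

lemma primitive_part_in_primitive_grid:
  assumes "x \<in> grid n"
  shows "primitive_part x \<in> primitive_grid (n div Gcd (range x))"
  using assms Gcd_range_pos[OF assms] Gcd_range_primitive_part[OF assms]
  by (simp add: primitive_grid_def scale_in_grid_iff[symmetric] scale_primitive_part)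

lemma primitive_grid_mono: "m \<le> n \<Longrightarrow> primitive_grid m \<subseteq> primitive_grid n"
  by (auto simp: primitive_grid_def grid_def Pi_iff intro: order_trans)

text \<open>Every grid point is uniquely its gcd times a primitive vector. Sorting the points by gcd
  \<open>Suc k\<close> leaves the primitive vectors of the grid shrunk by that factor.\<close>

lemma power_eq_sum_card_primitive_grid:
  "m ^ CARD('d) = (\<Sum>k<m. card (primitive_grid (m div Suc k) :: ('d::finite \<Rightarrow> nat) set))"
proof -
  let ?S = "Sigma {..<m} (\<lambda>k. primitive_grid (m div Suc k) :: ('d \<Rightarrow> nat) set)"
  have "bij_betw (\<lambda>(k, v) i. Suc k * v i) ?S (grid m)"
  proof (rule bij_betw_byWitness[where f' = "\<lambda>x. (Gcd (range x) - 1, primitive_part x)"])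
    show "\<forall>a\<in>?S. (Gcd (range ((\<lambda>(k, v) i. Suc k * v i) a)) - 1, primitive_part ((\<lambda>(k, v) i. Suc k * v i) a)) = a"
      by (auto simp: primitive_grid_def Gcd_range_scale primitive_part_scale simp del: mult_Suc)
    show "\<forall>x\<in>grid m. (\<lambda>(k, v) i. Suc k * v i) (Gcd (range x) - 1, primitive_part x) = x"
      using Gcd_range_pos by (fastforce simp: scale_primitive_part simp del: mult_Suc)
    show "(\<lambda>(k, v) i. Suc k * v i) ` ?S \<subseteq> grid m"
      by (auto simp: primitive_grid_def scale_in_grid_iff simp del: mult_Suc)
    show "(\<lambda>x. (Gcd (range x) - 1, primitive_part x)) ` grid m \<subseteq> ?S"
    proof (rule image_subsetI)
      fix x :: "'d \<Rightarrow> nat" assume x: "x \<in> grid m"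
      \<comment> \<open>Here \<open>undefined\<close> is just some index: any coordinate bounds the
        gcd, which puts \<open>Gcd (range x) - 1\<close> into the range of \<open>k\<close>.\<close>
      have "Gcd (range x) \<le> x undefined" "x undefined \<le> m" "x undefined > 0"
        using x Gcd_range_dvd[of x undefined] by (auto simp: grid_def Pi_iff Suc_le_eq intro: dvd_imp_le)
      then show "(Gcd (range x) - 1, primitive_part x) \<in> ?S"
        using Gcd_range_pos[OF x] primitive_part_in_primitive_grid[OF x] by auto
    qed
  qed
  then have "card ?S = m ^ CARD('d)"
    by (simp add: bij_betw_same_card card_grid)
  then show ?thesis by simp
qed

section \<open>Dominated series, floor quotients, and zeta and polylogarithm series\<close>

lemma tendsto_suminf_dominated:
  fixes a :: "nat \<Rightarrow> nat \<Rightarrow> real"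
  assumes "\<And>k. a k \<longlonglongrightarrow> b k" "\<And>k n. \<bar>a k n\<bar> \<le> h k" "summable h"
  shows "(\<lambda>n. \<Sum>k. a k n) \<longlonglongrightarrow> (\<Sum>k. b k)"
proof -
  have "\<forall>\<^sub>F (k, n) in sequentially \<times>\<^sub>F sequentially. norm (a k n) \<le> h k"
    using assms(2) by (intro always_eventually) auto
  from tannerys_theorem[OF assms(1) this assms(3)] show ?thesis by simp
qed

lemma div_ratio_le: "real (n div k) / real n \<le> 1 / real k"
proof (cases "n = 0 \<or> k = 0")
  case False
  then show ?thesis
    by (simp add: field_simps flip: of_nat_mult)
qed auto

lemma div_ratio_power_le: "(real (n div k) / real n) ^ d \<le> 1 / real k ^ d"
  using power_mono[OF div_ratio_le[of n k], of d] by (simp add: power_divide)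

lemma div_ratio_tendsto:
  assumes "k > 0"
  shows "(\<lambda>n. real (n div k) / real n) \<longlonglongrightarrow> 1 / real k"
proof (rule real_tendsto_sandwich)
  show "\<forall>\<^sub>F n in sequentially. 1 / real k - 1 / real n \<le> real (n div k) / real n"
    using eventually_gt_at_top[of 0]
  proof eventually_elim
    case (elim n)
    have "n \<le> (n div k) * k + k"
      using assms by (metis add_left_mono div_mult_mod_eq less_imp_le mod_less_divisor)
    then have "real n \<le> real (n div k) * real k + real k"
      by (metis of_nat_add of_nat_le_iff of_nat_mult)
    with assms have "real n / real k - 1 \<le> real (n div k)"
      by (simp add: field_simps)
    then have "(real n / real k - 1) / real n \<le> real (n div k) / real n"
      by (rule divide_right_mono) simp
    with elim show ?case by (simp add: diff_divide_distrib)
  qed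
  show "(\<lambda>n. 1 / real k - 1 / real n) \<longlonglongrightarrow> 1 / real k"
    using tendsto_diff[OF tendsto_const lim_1_over_n, of "1 / real k"] by simp
qed (use div_ratio_le in auto)

lemma summable_zeta: "d \<ge> 2 \<Longrightarrow> summable (\<lambda>k. 1 / real (Suc k) ^ d)"
  using inverse_power_summable[of d, where 'a = real] summable_Suc_iff[of "\<lambda>k. inverse (real k ^ d)"]
  by (simp add: inverse_eq_divide)

lemma summable_zeta_tail: "d \<ge> 2 \<Longrightarrow> summable (\<lambda>k. 1 / real (Suc (Suc k)) ^ d)"
  using summable_zeta by (subst (asm) summable_Suc_iff[symmetric])

lemma zeta_nat_split:
  "d \<ge> 2 \<Longrightarrow> zeta_nat d = 1 + (\<Sum>k. 1 / real (Suc (Suc k)) ^ d)"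
  unfolding zeta_nat_def using suminf_split_head[OF summable_zeta, of d] by simp

lemma suminf_zeta_tail_nonneg:
  assumes "d \<ge> 2"
  shows "0 \<le> (\<Sum>k. 1 / real (Suc (Suc k)) ^ d)"
  by (rule suminf_nonneg[OF summable_zeta_tail[OF assms]]) simp

text \<open>This makes \<open>zeta_nat d - 1\<close> a contraction factor. The series is compared
  with that of the inverse squares. Telescoping from the first term would give only the bound 1, so
  that term is split off: it is at most 1/4, and the rest telescopes to 1/2.\<close>

lemma suminf_zeta_tail_less_1:
  assumes "d \<ge> 2"
  shows "(\<Sum>k. 1 / real (Suc (Suc k)) ^ d) < 1"
proof -
  let ?f = "\<lambda>k. 1 / real (Suc (Suc k)) ^ d"
  have sm: "summable ?f"
    by (rule summable_zeta_tail[OF assms])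
  have "(\<lambda>k. 1 / real (k + 2)) \<longlonglongrightarrow> 0"
    using LIMSEQ_ignore_initial_segment[OF lim_1_over_n, of 2] by simp
  from telescope_sums'[OF this]
  have g: "(\<lambda>k. 1 / real (k + 2) - 1 / real (Suc k + 2)) sums (1 / 2)" by simp
  have le: "1 / real (Suc (Suc k)) ^ d \<le> 1 / (real (Suc (Suc k)))\<^sup>2" for k
    using assms by (intro divide_left_mono power_increasing) auto
  have "suminf ?f = ?f 0 + (\<Sum>k. ?f (Suc k))"
    using suminf_split_head[OF sm] by simp
  also have "(\<Sum>k. ?f (Suc k)) \<le> (\<Sum>k. 1 / real (k + 2) - 1 / real (Suc k + 2))"
  proof (rule suminf_le)
    show "summable (\<lambda>k. ?f (Suc k))" using sm by (subst summable_Suc_iff)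
    show "summable (\<lambda>k. 1 / real (k + 2) - 1 / real (Suc k + 2))" using g by (rule sums_summable)
    show "?f (Suc k) \<le> 1 / real (k + 2) - 1 / real (Suc k + 2)" for k
    proof -
      have "1 / (real (Suc (Suc (Suc k))))\<^sup>2 \<le> 1 / (real (k + 2) * real (k + 3))"
        unfolding power2_eq_square by (intro divide_left_mono mult_mono) auto
      also have "\<dots> = 1 / real (k + 2) - 1 / real (Suc k + 2)"
        by (simp add: field_simps)
      finally show ?thesis using le[of "Suc k"] by linarith
    qed
  qed
  also have "\<dots> = 1 / 2" using g by (rule sums_unique[symmetric])
  finally have "suminf ?f \<le> ?f 0 + 1 / 2" by simp
  moreover have "?f 0 \<le> 1 / 4" using le[of 0] by (simp add: power2_eq_square)
  ultimately show ?thesis by linarith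
qed

lemma zeta_nat_pos: "d \<ge> 2 \<Longrightarrow> zeta_nat d > 0"
  using suminf_zeta_tail_nonneg zeta_nat_split by fastforce

lemma summable_polylog:
  fixes z :: real
  assumes "d \<ge> 2" "0 \<le> z" "z \<le> 1"
  shows "summable (\<lambda>k. z ^ Suc k / real (Suc k) ^ d)"
proof (rule summable_comparison_test'[OF summable_zeta[OF assms(1)], of 0])
  fix k
  have "z ^ Suc k \<le> 1" using assms by (intro power_le_one)
  then show "norm (z ^ Suc k / real (Suc k) ^ d) \<le> 1 / real (Suc k) ^ d"
    using assms by (simp add: divide_right_mono del: power_Suc)
qed

lemma polylog_pos:
  assumes "d \<ge> 2" "0 < z" "z < 1"
  shows "polylog d z > 0"
  unfolding polylog_def using assms by (intro suminf_pos summable_polylog) auto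

section \<open>Density of the primitive vectors\<close>

text \<open>The type argument carries the dimension, which \<open>n\<close> alone does not
  determine.\<close>

definition primitive_ratio :: "'d::finite itself \<Rightarrow> nat \<Rightarrow> real" where
  "primitive_ratio _ n = card (primitive_grid n :: ('d \<Rightarrow> nat) set) / real n ^ CARD('d)"

lemma primitive_ratio_nonneg: "primitive_ratio TYPE('d::finite) n \<ge> 0"
  by (simp add: primitive_ratio_def)

lemma primitive_ratio_le_1: "primitive_ratio TYPE('d::finite) n \<le> 1"
proof -
  have "card (primitive_grid n :: ('d \<Rightarrow> nat) set) \<le> n ^ CARD('d)"
    unfolding card_grid[symmetric] by (intro card_mono) (auto simp: primitive_grid_def)
  then have "real (card (primitive_grid n :: ('d \<Rightarrow> nat) set)) \<le> real n ^ CARD('d)"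
    by (metis of_nat_le_iff of_nat_power)
  then show ?thesis by (simp add: primitive_ratio_def divide_le_eq)
qed

text \<open>The normalised count splits into a weight tending to \<open>1 / k ^ d\<close> (for
  \<open>k > 0\<close>) and a ratio in [0, 1], the form in which dominated convergence
  applies.\<close>

lemma card_primitive_grid_div:
  "card (primitive_grid (n div k) :: ('d::finite \<Rightarrow> nat) set) / real n ^ CARD('d)
    = (real (n div k) / real n) ^ CARD('d) * primitive_ratio TYPE('d) (n div k)"
proof (cases "n div k = 0")
  case True
  have "primitive_grid 0 = ({} :: ('d \<Rightarrow> nat) set)"
    by (auto simp: primitive_grid_def grid_def Pi_iff)
  then show ?thesis using True by (simp only:) simp
qed (simp add: primitive_ratio_def power_divide)

text \<open>The decomposition by gcd, divided by \<open>n ^ d\<close>. The terms with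
  \<open>k \<ge> n\<close> vanish because \<open>n div Suc k = 0\<close>, so the finite sum may be
  written as a series, ready for a limit under the sum.\<close>

lemma suminf_primitive_ratio:
  assumes "n > 0"
  shows "(\<Sum>k. (real (n div Suc k) / real n) ^ CARD('d::finite) * primitive_ratio TYPE('d) (n div Suc k)) = 1"
proof -
  have "(\<Sum>k. (real (n div Suc k) / real n) ^ CARD('d) * primitive_ratio TYPE('d) (n div Suc k))
     = (\<Sum>k<n. (real (n div Suc k) / real n) ^ CARD('d) * primitive_ratio TYPE('d) (n div Suc k))"
    by (rule suminf_finite) auto
  also have "\<dots> = (\<Sum>k<n. real (card (primitive_grid (n div Suc k) :: ('d \<Rightarrow> nat) set))) / real n ^ CARD('d)"
    by (simp only: card_primitive_grid_div[symmetric] sum_divide_distrib)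
  also have "\<dots> = real (n ^ CARD('d)) / real n ^ CARD('d)"
    unfolding power_eq_sum_card_primitive_grid[of n, where 'd = 'd] of_nat_sum ..
  also have "\<dots> = 1"
    using assms by simp
  finally show ?thesis .
qed

lemma filterlim_div_at_top:
  assumes "k > 0"
  shows "filterlim (\<lambda>n::nat. n div k) at_top at_top"
  unfolding filterlim_at_top
proof
  fix Z :: nat
  show "\<forall>\<^sub>F n in at_top. Z \<le> n div k"
    using eventually_ge_at_top[of "Z * k"]
    by eventually_elim (use assms in \<open>simp add: less_eq_div_iff_mult_less_eq\<close>)
qed

text \<open>Subtracting \<open>1/\<zeta>(d)\<close> from the ratios in \<open>suminf_primitive_ratio\<close> bounds the error at \<open>n\<close>
  by a null sequence plus errors at \<open>n div 2, n div 3, \<dots>\<close> of total weight \<open>\<zeta>(d) - 1 < 1\<close>,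
  so any asymptotic bound for the error improves by that factor.\<close>

lemma primitive_ratio_tendsto:
  assumes d: "CARD('d::finite) \<ge> 2"
  shows "primitive_ratio TYPE('d) \<longlonglongrightarrow> 1 / zeta_nat CARD('d)"
proof -
  define d where "d = CARD('d)"
  have d2: "d \<ge> 2" using d by (simp add: d_def)
  define a where "a = primitive_ratio TYPE('d)"
  define c where "c = 1 / zeta_nat d"
  define w where "w k n = (real (n div Suc k) / real n) ^ d" for k n
  define r where "r n = 1 - c * (\<Sum>k. w k n)" for n
  define E where "E n = \<bar>a n - c\<bar>" for n
  define q where "q = (\<Sum>k. 1 / real (Suc (Suc k)) ^ d)"
  have q: "0 \<le> q" "q < 1"
    using suminf_zeta_tail_nonneg[OF d2] suminf_zeta_tail_less_1[OF d2] by (auto simp: q_def)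
  have zpos: "zeta_nat d > 0" using zeta_nat_pos[OF d2] .
  then have cpos: "c > 0" by (simp add: c_def)
  have a01: "0 \<le> a n" "a n \<le> 1" for n
    by (simp_all add: a_def primitive_ratio_nonneg primitive_ratio_le_1)
  have E01: "0 \<le> E n" "E n \<le> 1 + c" for n
    using a01[of n] cpos by (auto simp: E_def abs_if)
  have w01: "0 \<le> w k n" "w k n \<le> 1 / real (Suc k) ^ d" for k n
    unfolding w_def by (simp, rule div_ratio_power_le)
  have w_lim: "w k \<longlonglongrightarrow> 1 / real (Suc k) ^ d" for k
    using tendsto_power[OF div_ratio_tendsto[of "Suc k"], of d]
    by (simp add: w_def[abs_def] power_divide)
  have wsum: "summable (\<lambda>k. w k n)" for n
    by (rule summable_comparison_test'[OF summable_zeta[OF d2], of 0]) (use w01 in auto)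
  have sm: "summable (\<lambda>k. w k n * f k)" if "\<And>k. \<bar>f k\<bar> \<le> C" for n f C
  proof (rule summable_comparison_test'[of "\<lambda>k. w k n * C", OF summable_mult2[OF wsum], of 0])
    show "norm (w k n * f k) \<le> w k n * C" for k
      using that[of k] w01[of k n] by (simp add: abs_mult mult_left_mono)
  qed
  have r_lim: "r \<longlonglongrightarrow> 0"
  proof -
    have "(\<lambda>n. \<Sum>k. w k n) \<longlonglongrightarrow> zeta_nat d"
      unfolding zeta_nat_def
      by (rule tendsto_suminf_dominated[OF w_lim _ summable_zeta[OF d2]]) (use w01 in auto)
    then have "r \<longlonglongrightarrow> 1 - c * zeta_nat d"
      unfolding r_def by (intro tendsto_intros)
    then show ?thesis using zpos by (simp add: c_def)
  qed
  have rec: "E n \<le> \<bar>r n\<bar> + (\<Sum>k. w (Suc k) n * E (n div Suc (Suc k)))" if n: "n > 0" for n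
  proof -
    have Cb: "\<bar>a m - c\<bar> \<le> 1 + c" for m using E01 by (simp add: E_def)
    have S1: "summable (\<lambda>k. w k n * (a (n div Suc k) - c))"
      by (rule sm[OF Cb])
    have S2: "summable (\<lambda>k. w k n * E (n div Suc k))"
      by (rule sm[where C="1 + c"]) (use E01 in auto)
    have S3: "summable (\<lambda>k. w k n * a (n div Suc k))"
      by (rule sm[where C=1]) (use a01 in auto)
    have "(\<Sum>k. w k n * (a (n div Suc k) - c)) = (\<Sum>k. w k n * a (n div Suc k)) - (\<Sum>k. w k n * c)"
      unfolding right_diff_distrib by (rule suminf_diff[symmetric, OF S3 summable_mult2[OF wsum]])
    also have "(\<Sum>k. w k n * a (n div Suc k)) = 1"
      using suminf_primitive_ratio[OF n, where 'd='d] by (simp add: w_def a_def d_def)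
    also have "(\<Sum>k. w k n * c) = c * (\<Sum>k. w k n)"
      using suminf_mult2[OF wsum, of n c] by (simp add: mult.commute)
    finally have "(\<Sum>k. w k n * (a (n div Suc k) - c)) = r n"
      by (simp add: r_def)
    \<comment> \<open>Index 0 stands for gcd 1. Its weight is 1, so the head of the series is the
      error at \<open>n\<close> itself and can be isolated.\<close>
    moreover have "w 0 n = 1" using n by (simp add: w_def)
    ultimately have "a n - c = r n - (\<Sum>k. w (Suc k) n * (a (n div Suc (Suc k)) - c))"
      using suminf_split_head[OF S1] by simp
    moreover have "\<bar>\<Sum>k. w (Suc k) n * (a (n div Suc (Suc k)) - c)\<bar>
        \<le> (\<Sum>k. w (Suc k) n * E (n div Suc (Suc k)))"
    proof -
      have eq: "\<bar>w (Suc k) n * (a (n div Suc (Suc k)) - c)\<bar> = w (Suc k) n * E (n div Suc (Suc k))" for k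
        using w01[of "Suc k" n] by (simp add: abs_mult E_def)
      have "summable (\<lambda>k. w (Suc k) n * E (n div Suc (Suc k)))"
        using S2 by (subst (asm) summable_Suc_iff[symmetric])
      then show ?thesis
        using summable_rabs[of "\<lambda>k. w (Suc k) n * (a (n div Suc (Suc k)) - c)"] by (simp only: eq)
    qed
    ultimately show ?thesis unfolding E_def by linarith
  qed
  \<comment> \<open>Convergence of \<open>max (E n) b\<close> to \<open>b\<close> expresses that the
    limit superior of \<open>E\<close> is at most \<open>b\<close>, in a form that passes through
    the series by dominated convergence. One use of \<open>rec\<close> improves the bound from
    \<open>b\<close> to \<open>q * b\<close>.\<close>
  have step: "(\<lambda>n. max (E n) (q * b)) \<longlonglongrightarrow> q * b"
    if b: "b \<ge> 0" and lim: "(\<lambda>n. max (E n) b) \<longlonglongrightarrow> b" for b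
  proof -
    let ?a = "\<lambda>k n. w (Suc k) n * max (E (n div Suc (Suc k))) b"
    have mb: "\<bar>max (E m) b\<bar> \<le> 1 + c + b" for m
      using E01[of m] b cpos by auto
    have sh: "summable (\<lambda>k. 1 / real (Suc (Suc k)) ^ d)"
      by (rule summable_zeta_tail[OF d2])
    have "(\<lambda>n. \<Sum>k. ?a k n) \<longlonglongrightarrow> (\<Sum>k. 1 / real (Suc (Suc k)) ^ d * b)"
    proof (rule tendsto_suminf_dominated)
      show "?a k \<longlonglongrightarrow> 1 / real (Suc (Suc k)) ^ d * b" for k
        by (intro tendsto_mult w_lim filterlim_compose[OF lim filterlim_div_at_top]) simp
      show "\<bar>?a k n\<bar> \<le> 1 / real (Suc (Suc k)) ^ d * (1 + c + b)" for k n
        unfolding abs_mult using w01[of "Suc k" n] mb by (intro mult_mono) auto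
      show "summable (\<lambda>k. 1 / real (Suc (Suc k)) ^ d * (1 + c + b))"
        by (rule summable_mult2[OF sh])
    qed
    also have "(\<Sum>k. 1 / real (Suc (Suc k)) ^ d * b) = q * b"
      unfolding q_def by (rule suminf_mult2[OF sh, symmetric])
    finally have "(\<lambda>n. max (\<bar>r n\<bar> + (\<Sum>k. ?a k n)) (q * b)) \<longlonglongrightarrow> max (\<bar>0\<bar> + q * b) (q * b)"
      by (intro tendsto_max tendsto_add tendsto_rabs r_lim tendsto_const)
    then have up: "(\<lambda>n. max (\<bar>r n\<bar> + (\<Sum>k. ?a k n)) (q * b)) \<longlonglongrightarrow> q * b" by simp
    show ?thesis
    proof (rule real_tendsto_sandwich[OF _ _ tendsto_const up])
      show "\<forall>\<^sub>F n in sequentially. max (E n) (q * b) \<le> max (\<bar>r n\<bar> + (\<Sum>k. ?a k n)) (q * b)"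
        using eventually_gt_at_top[of 0]
      proof eventually_elim
        case (elim n)
        have "summable (\<lambda>k. w k n * max (E (n div Suc k)) b)"
          by (rule sm[OF mb])
        then have "summable (\<lambda>k. ?a k n)" by (subst (asm) summable_Suc_iff[symmetric])
        moreover have "summable (\<lambda>k. w k n * E (n div Suc k))"
          by (rule sm[where C="1 + c"]) (use E01 in auto)
        then have "summable (\<lambda>k. w (Suc k) n * E (n div Suc (Suc k)))"
          by (subst (asm) summable_Suc_iff[symmetric])
        ultimately have "(\<Sum>k. w (Suc k) n * E (n div Suc (Suc k))) \<le> (\<Sum>k. ?a k n)"
          using w01 by (intro suminf_le mult_left_mono) auto
        then show ?case using rec[OF elim] by auto
      qed
    qed auto
  qed
  \<comment> \<open>The iteration starts from the uniform bound \<open>1 + c\<close> on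
    \<open>E\<close>; since \<open>q < 1\<close>, the bounds become arbitrarily small.\<close>
  have iter: "(\<lambda>n. max (E n) (q ^ j * (1 + c))) \<longlonglongrightarrow> q ^ j * (1 + c)" for j
  proof (induction j)
    case 0
    have "max (E n) (1 + c) = 1 + c" for n using E01[of n] by simp
    then show ?case by simp
  next
    case (Suc j)
    then show ?case using step[of "q ^ j * (1 + c)"] q cpos by (simp add: mult.assoc)
  qed
  have "E \<longlonglongrightarrow> 0"
  proof (rule tendstoI)
    fix e :: real assume e: "e > 0"
    have "(\<lambda>j. q ^ j * (1 + c)) \<longlonglongrightarrow> 0 * (1 + c)"
      using q by (intro tendsto_mult LIMSEQ_realpow_zero tendsto_const)
    then have "\<forall>\<^sub>F j in sequentially. q ^ j * (1 + c) < e"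
      using e by (intro order_tendstoD) simp_all
    then obtain j where "q ^ j * (1 + c) < e"
      by (auto simp: eventually_sequentially)
    from order_tendstoD(2)[OF iter this]
    show "\<forall>\<^sub>F n in sequentially. dist (E n) 0 < e"
      by eventually_elim (use E01 in auto)
  qed
  then have "(\<lambda>n. a n - c) \<longlonglongrightarrow> 0"
    unfolding E_def by (rule tendsto_rabs_zero_cancel)
  then show ?thesis
    by (simp add: LIM_zero_iff a_def c_def d_def)
qed

section \<open>Expected number of rays that are hit\<close>

text \<open>A multiple of \<open>v\<close> stays in the grid as long as its largest coordinate does.
  Hence \<open>n div Max (range v)\<close> is the number of positive multiples of \<open>v\<close>
  in the grid.\<close>

lemma Suc_le_div_Max_iff:
  fixes v :: "'d::finite \<Rightarrow> nat"
  assumes "v \<in> grid n"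
  shows "Suc k \<le> n div Max (range v) \<longleftrightarrow> (\<lambda>i. Suc k * v i) \<in> grid n"
proof -
  have v: "v i > 0" for i using assms by (auto simp: grid_def Pi_iff Suc_le_eq)
  have "Max (range v) > 0"
    using v[of undefined] Max_ge[of "range v" "v undefined"] by (simp add: less_le_trans)
  then have "Suc k \<le> n div Max (range v) \<longleftrightarrow> Suc k * Max (range v) \<le> n"
    by (rule less_eq_div_iff_mult_less_eq)
  also have "\<dots> \<longleftrightarrow> Max (range v) \<le> n div Suc k"
    by (simp add: less_eq_div_iff_mult_less_eq mult.commute del: mult_Suc)
  also have "\<dots> \<longleftrightarrow> (\<forall>i. v i \<le> n div Suc k)"
    by (subst Max_le_iff) auto
  also have "\<dots> \<longleftrightarrow> v \<in> grid (n div Suc k)"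
    using v by (auto simp: grid_def Pi_iff Suc_le_eq)
  finally show ?thesis by (simp add: scale_in_grid_iff del: mult_Suc)
qed

text \<open>Each summand on the left is a finite geometric sum. After exchanging the sums, a fixed
  \<open>k\<close> collects the primitive vectors with at least \<open>Suc k\<close> multiples in
  the grid, which are those of \<open>primitive_grid (n div Suc k)\<close>.\<close>

lemma sum_primitive_grid_geometric:
  fixes p :: real
  assumes p: "0 < p" "p < 1"
  shows "(\<Sum>v\<in>(primitive_grid n :: ('d::finite \<Rightarrow> nat) set). 1 - (1 - p) ^ (n div Max (range v)))
    = (\<Sum>k<n. p * (1 - p) ^ k * card (primitive_grid (n div Suc k) :: ('d \<Rightarrow> nat) set))"
proof -
  let ?R = "primitive_grid n :: ('d \<Rightarrow> nat) set"
  \<comment> \<open>The quotient never exceeds \<open>n\<close>, so all inner sums can share the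
    range \<open>k < n\<close>, with a condition inside; this permits the exchange.\<close>
  have "(\<Sum>v\<in>?R. 1 - (1 - p) ^ (n div Max (range v)))
      = (\<Sum>v\<in>?R. \<Sum>k<n. if Suc k \<le> n div Max (range v) then p * (1 - p) ^ k else 0)"
  proof (rule sum.cong[OF refl])
    fix v :: "'d \<Rightarrow> nat"
    have "{k. k < n \<and> Suc k \<le> n div Max (range v)} = {..<n div Max (range v)}"
      by (auto intro: order_less_le_trans[OF _ div_le_dividend])
    then have "(\<Sum>k<n. if Suc k \<le> n div Max (range v) then p * (1 - p) ^ k else 0)
        = (\<Sum>k<n div Max (range v). p * (1 - p) ^ k)"
      by (subst sum.inter_filter[symmetric]) auto
    also have "\<dots> = 1 - (1 - p) ^ (n div Max (range v))"
      using p one_diff_power_eq[of "1 - p" "n div Max (range v)"] by (simp add: sum_distrib_left)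
    finally show "1 - (1 - p) ^ (n div Max (range v))
      = (\<Sum>k<n. if Suc k \<le> n div Max (range v) then p * (1 - p) ^ k else 0)" ..
  qed
  also have "\<dots> = (\<Sum>k<n. \<Sum>v\<in>?R. if Suc k \<le> n div Max (range v) then p * (1 - p) ^ k else 0)"
    by (rule sum.swap)
  also have "\<dots> = (\<Sum>k<n. p * (1 - p) ^ k * card (primitive_grid (n div Suc k) :: ('d \<Rightarrow> nat) set))"
  proof (rule sum.cong[OF refl])
    fix k
    have "{v \<in> ?R. Suc k \<le> n div Max (range v)} = primitive_grid (n div Suc k)"
      using primitive_grid_mono[OF div_le_dividend, of n "Suc k", where 'a='d]
      by (auto simp: primitive_grid_def Suc_le_div_Max_iff scale_in_grid_iff simp del: mult_Suc)
    then show "(\<Sum>v\<in>?R. if Suc k \<le> n div Max (range v) then p * (1 - p) ^ k else 0)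
       = p * (1 - p) ^ k * card (primitive_grid (n div Suc k) :: ('d \<Rightarrow> nat) set)"
      by (subst sum.inter_filter[symmetric]) auto
  qed
  finally show ?thesis .
qed

lemma sum_primitive_grid_geometric_tendsto:
  fixes p :: real
  assumes d: "CARD('d::finite) \<ge> 2" and p: "0 < p" "p < 1"
  shows "(\<lambda>n. (\<Sum>v\<in>(primitive_grid n :: ('d \<Rightarrow> nat) set). 1 - (1 - p) ^ (n div Max (range v))) / real n ^ CARD('d))
    \<longlonglongrightarrow> p / zeta_nat CARD('d) * (polylog CARD('d) (1 - p) / (1 - p))"
proof -
  define d where "d = CARD('d)"
  let ?a = "\<lambda>k n. p * (1 - p) ^ k * ((real (n div Suc k) / real n) ^ d * primitive_ratio TYPE('d) (n div Suc k))"
  let ?b = "\<lambda>k. p * (1 - p) ^ k * ((1 / real (Suc k)) ^ d * (1 / zeta_nat d))"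
  have "(\<Sum>v\<in>(primitive_grid n :: ('d \<Rightarrow> nat) set). 1 - (1 - p) ^ (n div Max (range v))) / real n ^ d
      = (\<Sum>k. ?a k n)" for n
  proof -
    have "(\<Sum>k. ?a k n) = (\<Sum>k<n. ?a k n)"
      by (rule suminf_finite) (auto simp: d_def)
    also have "\<dots> = (\<Sum>k<n. p * (1 - p) ^ k * (card (primitive_grid (n div Suc k) :: ('d \<Rightarrow> nat) set) / real n ^ d))"
      unfolding d_def card_primitive_grid_div ..
    finally show ?thesis
      unfolding sum_primitive_grid_geometric[OF p] by (simp add: sum_divide_distrib)
  qed
  moreover have "(\<lambda>n. \<Sum>k. ?a k n) \<longlonglongrightarrow> (\<Sum>k. ?b k)"
  proof (rule tendsto_suminf_dominated)
    show "?a k \<longlonglongrightarrow> ?b k" for k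
      by (intro tendsto_mult tendsto_const tendsto_power div_ratio_tendsto
          filterlim_compose[OF primitive_ratio_tendsto[OF d, folded d_def] filterlim_div_at_top]) simp_all
    \<comment> \<open>Weight and ratio are both at most 1, so the geometric series with terms
      \<open>p * (1 - p) ^ k\<close> dominates.\<close>
    have "(real (n div Suc k) / real n) ^ d \<le> 1" for n k
      using div_ratio_power_le[of n "Suc k" d] by (simp add: order_trans[OF _ divide_le_eq_1_pos[THEN iffD2]])
    then have "(real (n div Suc k) / real n) ^ d * primitive_ratio TYPE('d) (n div Suc k) \<le> 1" for n k
      by (intro mult_le_one primitive_ratio_nonneg primitive_ratio_le_1)
    moreover have "0 \<le> (real (n div Suc k) / real n) ^ d * primitive_ratio TYPE('d) (n div Suc k)" for n k
      by (simp add: primitive_ratio_nonneg)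
    ultimately show "\<bar>?a k n\<bar> \<le> p * (1 - p) ^ k" for k n
      using p by (subst abs_of_nonneg) (auto intro!: mult_left_le mult_nonneg_nonneg)
    show "summable (\<lambda>k. p * (1 - p) ^ k)"
      using p by (intro summable_mult summable_geometric) auto
  qed
  moreover have "(\<Sum>k. ?b k) = p / zeta_nat d * (polylog d (1 - p) / (1 - p))"
  proof -
    have sm: "summable (\<lambda>k. (1 - p) ^ Suc k / real (Suc k) ^ d)"
      using d p by (intro summable_polylog) (auto simp: d_def)
    \<comment> \<open>The geometric weights carry the exponent \<open>k\<close>, the polylogarithm
      \<open>Suc k\<close>; this shift produces the division by \<open>1 - p\<close> in the
      limit.\<close>
    have "?b = (\<lambda>k. p / zeta_nat d / (1 - p) * ((1 - p) ^ Suc k / real (Suc k) ^ d))"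
      using p by (simp add: power_divide fun_eq_iff)
    then show ?thesis
      unfolding polylog_def using suminf_mult[OF sm, of "p / zeta_nat d / (1 - p)"] by simp
  qed
  ultimately show ?thesis by (simp add: d_def)
qed

subsection \<open>Visible points and primitive rays\<close>

lemma in_grid_of_subset: "(\<And>i. A i \<subseteq> {1..n}) \<Longrightarrow> \<forall>i. x i \<in> A i \<Longrightarrow> x \<in> grid n"
  unfolding grid_def Pi_iff by blast

text \<open>This turns visibility into arithmetic: a ray is determined by its primitive vector, and
  the gcd measures the position along it. Conversely, the scaling factor of the segment is the
  quotient of the gcds.\<close>

lemma embed_in_segment_iff:
  fixes x y :: "'d::finite \<Rightarrow> nat"
  assumes x: "x \<in> grid n" and y: "y \<in> grid n"
  shows "(\<chi> i. real (y i)) \<in> closed_segment 0 (\<chi> i. real (x i))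
    \<longleftrightarrow> primitive_part y = primitive_part x \<and> Gcd (range y) \<le> Gcd (range x)"
proof
  let ?gx = "Gcd (range x)" and ?gy = "Gcd (range y)"
  have pos: "?gx > 0" "?gy > 0" using Gcd_range_pos x y by auto
  have xpos: "x i > 0" for i using x by (auto simp: grid_def Pi_iff Suc_le_eq)
  {
    assume "(\<chi> i. real (y i)) \<in> closed_segment 0 (\<chi> i. real (x i))"
    then obtain u where u: "0 \<le> u" "u \<le> 1" "\<And>i. real (y i) = u * real (x i)"
      by (auto simp: in_segment vec_eq_iff)
    \<comment> \<open>Cross-multiplication eliminates \<open>u\<close>; taking gcds over
      \<open>l\<close> on both sides then relates each coordinate to the two gcds.\<close>
    have "real (y i * x l) = real (x i * y l)" for i l
      by (simp add: u(3))
    then have "y i * x l = x i * y l" for i l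
      using of_nat_eq_iff by blast
    then have "y i * ?gx = x i * ?gy" for i
      using Gcd_range_scale[of "y i" x] Gcd_range_scale[of "x i" y] by simp
    then have "(?gx * ?gy) * primitive_part y i = (?gx * ?gy) * primitive_part x i" for i
      by (metis scale_primitive_part mult.assoc mult.commute)
    then have eq: "primitive_part y = primitive_part x"
      using pos by (metis mult_left_cancel mult_is_0 neq0_conv ext)
    have "real (y undefined) \<le> real (x undefined)"
      using u by (simp add: mult_left_le_one_le)
    then have "?gy * primitive_part x undefined \<le> ?gx * primitive_part x undefined"
      using scale_primitive_part[of y undefined] scale_primitive_part[of x undefined] eq by simp
    moreover have "primitive_part x undefined > 0"
      using scale_primitive_part[of x undefined] xpos[of undefined] by (metis mult_0_right neq0_conv)
    ultimately show "primitive_part y = primitive_part x \<and> ?gy \<le> ?gx" using eq by simp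
  next
    assume r: "primitive_part y = primitive_part x \<and> ?gy \<le> ?gx"
    have "real (y i) = real ?gy / real ?gx * real (x i)" for i
    proof -
      have "y i * ?gx = ?gy * x i"
        using r scale_primitive_part[of y i] scale_primitive_part[of x i] by (metis mult.assoc mult.commute)
      then have "real (y i) * real ?gx = real ?gy * real (x i)"
        by (metis of_nat_mult)
      moreover have "real ?gx \<noteq> 0"
        using pos by (metis of_nat_eq_0_iff neq0_conv)
      ultimately show ?thesis by (metis nonzero_eq_divide_eq times_divide_eq_left)
    qed
    then show "(\<chi> i. real (y i)) \<in> closed_segment 0 (\<chi> i. real (x i))"
      using r pos by (auto simp: in_segment vec_eq_iff intro!: exI[of _ "real ?gy / real ?gx"])
  }
qed

text \<open>Each ray that meets the product carries exactly one visible point, the one with the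
  least gcd. Thus \<open>primitive_part\<close> is a bijection from the visible points to the
  primitive vectors of the rays that are hit.\<close>

lemma card_visible_lattice_product:
  fixes A :: "'d::finite \<Rightarrow> nat set"
  assumes A: "\<And>i. A i \<subseteq> {1..n}"
  shows "card (visible (lattice_product A))
    = card {v \<in> primitive_grid n. \<exists>j\<in>{1..n div Max (range v)}. \<forall>i. j * v i \<in> A i}"
proof -
  \<comment> \<open>\<open>X\<close> is the set of visible points in natural coordinates, with the
    segment condition in its arithmetic form.\<close>
  define X where "X = {x. (\<forall>i. x i \<in> A i) \<and>
    (\<forall>y. (\<forall>i. y i \<in> A i) \<and> primitive_part y = primitive_part x \<and> Gcd (range y) \<le> Gcd (range x) \<longrightarrow> y = x)}"
  let ?e = "\<lambda>x. (\<chi> i. real (x i)) :: real ^ 'd"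
  have inj: "inj ?e" by (auto simp: inj_def vec_eq_iff fun_eq_iff)
  have lp: "lattice_product A = ?e ` {x. \<forall>i. x i \<in> A i}"
  proof (intro set_eqI iffI)
    fix P assume "P \<in> lattice_product A"
    then have "\<forall>i. \<exists>m. m \<in> A i \<and> P $ i = real m" by (auto simp: lattice_product_def)
    then obtain x where "\<And>i. x i \<in> A i \<and> P $ i = real (x i)" by metis
    then show "P \<in> ?e ` {x. \<forall>i. x i \<in> A i}" by (auto simp: vec_eq_iff)
  qed (auto simp: lattice_product_def)
  have "visible (lattice_product A) = ?e ` X"
  proof (intro set_eqI iffI)
    fix P assume P: "P \<in> visible (lattice_product A)"
    then obtain x where x: "P = ?e x" "\<forall>i. x i \<in> A i" by (auto simp: visible_def lp)
    have "y = x" if "\<forall>i. y i \<in> A i" "primitive_part y = primitive_part x" "Gcd (range y) \<le> Gcd (range x)" for y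
    proof -
      have "?e y \<in> closed_segment 0 P"
        using that x embed_in_segment_iff[OF in_grid_of_subset[OF A x(2)] in_grid_of_subset[OF A that(1)]] by simp
      then have "?e y = P" using P that(1) by (auto simp: visible_def lp)
      then show ?thesis using x(1) by (intro injD[OF inj, of y x]) simp
    qed
    then show "P \<in> ?e ` X" using x by (auto simp: X_def)
  next
    fix P assume "P \<in> ?e ` X"
    then obtain x where x: "P = ?e x" "x \<in> X" by auto
    then have xA: "\<forall>i. x i \<in> A i" by (simp add: X_def)
    have "Q = P" if Q: "Q \<in> closed_segment 0 P" "Q \<in> lattice_product A" for Q
    proof -
      obtain y where y: "Q = ?e y" "\<forall>i. y i \<in> A i" using Q(2) by (auto simp: lp)
      then have "primitive_part y = primitive_part x \<and> Gcd (range y) \<le> Gcd (range x)"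
        using Q(1) x(1) embed_in_segment_iff[OF in_grid_of_subset[OF A xA] in_grid_of_subset[OF A y(2)]] by simp
      then show ?thesis using x y by (auto simp: X_def)
    qed
    then show "P \<in> visible (lattice_product A)"
      using x xA by (auto simp: visible_def lp)
  qed
  then have "card (visible (lattice_product A)) = card X"
    using inj by (simp add: card_image inj_on_subset)
  also have "\<dots> = card {v \<in> primitive_grid n. \<exists>j\<in>{1..n div Max (range v)}. \<forall>i. j * v i \<in> A i}"
    (is "_ = card ?T")
  proof (rule bij_betw_same_card[of primitive_part], unfold bij_betw_def, intro conjI set_eqI iffI)
    \<comment> \<open>Of two members of \<open>X\<close> on one ray, the one with the larger gcd
      must equal the other by its defining condition.\<close>
    show "inj_on primitive_part X"
    proof (rule inj_onI)
      fix x y assume "x \<in> X" "y \<in> X" "primitive_part x = primitive_part y"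
      then show "x = y"
        unfolding X_def by (cases "Gcd (range x) \<le> Gcd (range y)") auto
    qed
  next
    fix v assume "v \<in> primitive_part ` X"
    then obtain x where x: "v = primitive_part x" "\<forall>i. x i \<in> A i" by (auto simp: X_def)
    have xb: "x \<in> grid n" by (rule in_grid_of_subset[OF A x(2)])
    have v: "v \<in> primitive_grid n"
      using primitive_part_in_primitive_grid[OF xb] primitive_grid_mono[OF div_le_dividend] x(1) by blast
    moreover have g: "Gcd (range x) = Suc (Gcd (range x) - 1)" using Gcd_range_pos[OF xb] by simp
    have "Gcd (range x) \<le> n div Max (range v)"
      using Suc_le_div_Max_iff[of v n "Gcd (range x) - 1", folded g] v xb
      by (auto simp: primitive_grid_def x(1) scale_primitive_part)
    ultimately show "v \<in> ?T"
      using x Gcd_range_pos[OF xb] by (auto simp: scale_primitive_part Suc_le_eq intro!: bexI[of _ "Gcd (range x)"])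
  next
    fix v assume v: "v \<in> ?T"
    define P where "P j \<longleftrightarrow> j \<ge> 1 \<and> (\<forall>i. j * v i \<in> A i)" for j
    \<comment> \<open>The least multiplier taking \<open>v\<close> into the product gives the
      visible point on its ray.\<close>
    define k where "k = Least P"
    have "\<exists>j. P j" using v by (auto simp: P_def)
    then have k: "P k" unfolding k_def by (rule LeastI_ex)
    have v1: "Gcd (range v) = 1" using v by (simp add: primitive_grid_def)
    let ?x = "\<lambda>i. k * v i"
    have red: "primitive_part ?x = v" "Gcd (range ?x) = k"
      using k v1 by (simp_all add: P_def primitive_part_scale Gcd_range_scale)
    have "y = ?x" if y: "\<forall>i. y i \<in> A i" "primitive_part y = v" "Gcd (range y) \<le> k" for y
    proof -
      have "P (Gcd (range y))"
        using y Gcd_range_pos[OF in_grid_of_subset[OF A y(1)]] scale_primitive_part[of y]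
        by (auto simp: P_def Suc_le_eq)
      then have "k \<le> Gcd (range y)" unfolding k_def by (rule Least_le)
      then show ?thesis using y scale_primitive_part[of y] by (auto simp: fun_eq_iff)
    qed
    then have "?x \<in> X" using k red by (auto simp: X_def P_def)
    then show "v \<in> primitive_part ` X" using red(1) by (metis imageI)
  qed
  finally show ?thesis .
qed

section \<open>Dependence between rays\<close>

text \<open>A cell \<open>(i, m)\<close> stands for the random choice whether \<open>m\<close>
  belongs to \<open>A i\<close>. The cells listed here are the choices that decide whether the ray
  of \<open>v\<close> is hit.\<close>

definition ray_cells :: "nat \<Rightarrow> ('d \<Rightarrow> nat) \<Rightarrow> ('d \<times> nat) set" where
  "ray_cells n v = (\<lambda>(i, j). (i, j * v i)) ` (UNIV \<times> {1..n div Max (range v)})"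

lemma card_grid_coordinate:
  fixes i :: "'d::finite"
  assumes "a \<in> {1..n}"
  shows "card {y \<in> grid n. y i = a} = n ^ (CARD('d) - 1)"
proof -
  have "{y \<in> grid n. y i = a} = PiE UNIV (\<lambda>l. if l = i then {a} else {1..n})"
    using assms by (auto simp: grid_def PiE_UNIV_domain Pi_iff split: if_splits)
  also have "card \<dots> = (\<Prod>l\<in>UNIV. if l = i then 1 else n)"
    by (subst card_PiE) (auto intro!: prod.cong)
  also have "\<dots> = n ^ (CARD('d) - 1)"
    by (subst prod.If_cases) (auto simp: Compl_eq_Diff_UNIV card_Diff_singleton)
  finally show ?thesis .
qed

lemma multiple_in_grid:
  fixes v :: "'d::finite \<Rightarrow> nat"
  assumes "v \<in> primitive_grid n" "j \<in> {1..n div Max (range v)}"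
  shows "(\<lambda>i. j * v i) \<in> grid n"
proof -
  obtain k where "j = Suc k" using assms(2) by (cases j) auto
  then show ?thesis
    using Suc_le_div_Max_iff[of v n k] assms by (auto simp: primitive_grid_def simp del: mult_Suc)
qed

lemma ray_cells_subset:
  fixes v :: "'d::finite \<Rightarrow> nat"
  assumes "v \<in> primitive_grid n"
  shows "ray_cells n v \<subseteq> UNIV \<times> {1..n}"
  using multiple_in_grid[OF assms] by (force simp: ray_cells_def grid_def Pi_iff)

text \<open>A common cell of two rays yields points \<open>x\<close>, \<open>y\<close> on them sharing a coordinate, and the rays are
  recovered from these points. This saves the divisor sums of a direct count.\<close>

lemma card_intersecting_rays_le:
  "card ({(v, w). ray_cells n v \<inter> ray_cells n w \<noteq> {}} \<inter> primitive_grid n \<times> (primitive_grid n :: ('d::finite \<Rightarrow> nat) set))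
    \<le> CARD('d) * (n ^ CARD('d) * n ^ (CARD('d) - 1))"
proof -
  let ?S = "\<lambda>i. SIGMA x:(grid n :: ('d \<Rightarrow> nat) set). {y \<in> grid n. y i = x i}"
  have fin: "finite (?S i)" for i by (intro finite_SigmaI) auto
  have cS: "card (?S i) = n ^ CARD('d) * n ^ (CARD('d) - 1)" for i
  proof -
    have "card (?S i) = (\<Sum>x\<in>(grid n :: ('d \<Rightarrow> nat) set). card {y \<in> grid n. y i = x i})"
      by (subst card_SigmaI) auto
    also have "\<dots> = (\<Sum>x\<in>(grid n :: ('d \<Rightarrow> nat) set). n ^ (CARD('d) - 1))"
      by (intro sum.cong refl card_grid_coordinate) (auto simp: grid_def Pi_iff)
    finally show ?thesis by (simp add: card_grid)
  qed
  have "{(v, w). ray_cells n v \<inter> ray_cells n w \<noteq> {}} \<inter> primitive_grid n \<times> (primitive_grid n :: ('d \<Rightarrow> nat) set)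
    \<subseteq> (\<Union>i. map_prod primitive_part primitive_part ` ?S i)"
  proof clarify
    fix v w :: "'d \<Rightarrow> nat"
    assume v: "v \<in> primitive_grid n" and w: "w \<in> primitive_grid n"
      and "ray_cells n v \<inter> ray_cells n w \<noteq> {}"
    then obtain c where c: "c \<in> ray_cells n v" "c \<in> ray_cells n w" by blast
    obtain i j where j: "j \<in> {1..n div Max (range v)}" and cv: "c = (i, j * v i)"
      using c(1) by (auto simp: ray_cells_def)
    obtain l where l: "l \<in> {1..n div Max (range w)}" and eq: "j * v i = l * w i"
      using c(2) cv by (auto simp: ray_cells_def)
    let ?x = "\<lambda>i. j * v i" and ?y = "\<lambda>i. l * w i"
    have "(?x, ?y) \<in> ?S i"
      using multiple_in_grid[OF v j] multiple_in_grid[OF w l] eq by simp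
    moreover have "(v, w) = map_prod primitive_part primitive_part (?x, ?y)"
      using v w j l by (simp add: primitive_part_scale primitive_grid_def)
    ultimately show "(v, w) \<in> (\<Union>i. map_prod primitive_part primitive_part ` ?S i)"
      by blast
  qed
  then have "card ({(v, w). ray_cells n v \<inter> ray_cells n w \<noteq> {}} \<inter> primitive_grid n \<times> (primitive_grid n :: ('d \<Rightarrow> nat) set))
      \<le> card (\<Union>i. map_prod primitive_part primitive_part ` ?S i)"
    by (rule card_mono[rotated]) (use fin in auto)
  also have "\<dots> \<le> (\<Sum>i\<in>UNIV. card (map_prod primitive_part primitive_part ` ?S i))"
    by (rule card_UN_le) simp
  also have "\<dots> \<le> (\<Sum>i\<in>(UNIV::'d set). n ^ CARD('d) * n ^ (CARD('d) - 1))"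
    by (intro sum_mono order_trans[OF card_image_le[OF fin]]) (simp add: cS)
  finally show ?thesis by simp
qed

section \<open>Ray events and concentration of the visible count\<close>

context prob_space
begin

text \<open>The ray of \<open>v\<close> is missed iff no multiple of \<open>v\<close> in the grid
  lies in the product. Distinct multiples use disjoint cells, so these failures are independent,
  each with probability one minus the product of the \<open>\<alpha> i\<close>. Rays without a
  common cell depend on disjoint families of choices.\<close>

lemma
  fixes A :: "'d::finite \<Rightarrow> 'a \<Rightarrow> nat set" and \<alpha> :: "'d \<Rightarrow> real"
  assumes iv: "indep_vars (\<lambda>i. count_space (Pow {1..n})) A UNIV"
    and ie: "\<And>i. indep_events (\<lambda>m. {\<omega> \<in> space M. m \<in> A i \<omega>}) {1..n}"
    and al: "\<And>i m. m \<in> {1..n} \<Longrightarrow> prob {\<omega> \<in> space M. m \<in> A i \<omega>} = \<alpha> i"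
  defines "F \<equiv> \<lambda>v. {\<omega> \<in> space M. \<exists>j\<in>{1..n div Max (range v)}. \<forall>i. j * v i \<in> A i \<omega>}"
  shows ray_event: "v \<in> primitive_grid n \<Longrightarrow> F v \<in> events"
    and prob_ray_event: "v \<in> primitive_grid n \<Longrightarrow> prob (F v) = 1 - (1 - (\<Prod>i\<in>UNIV. \<alpha> i)) ^ (n div Max (range v))"
    and prob_ray_events_Int: "v \<in> primitive_grid n \<Longrightarrow> w \<in> primitive_grid n \<Longrightarrow>
      ray_cells n v \<inter> ray_cells n w = {} \<Longrightarrow> prob (F v \<inter> F w) = prob (F v) * prob (F w)"
proof -
  define X :: "'d \<times> nat \<Rightarrow> 'a \<Rightarrow> bool" where "X = (\<lambda>(i, m) \<omega>. m \<in> A i \<omega>)"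
  have ind: "indep_vars (\<lambda>_. count_space UNIV) X (UNIV \<times> {1..n})"
    unfolding X_def by (rule indep_vars_random_sets_mem[OF iv ie])
  define f where "f v x \<longleftrightarrow> (\<exists>j\<in>{1..n div Max (range v)}. \<forall>i. x (i, j * v i))"
    for v and x :: "'d \<times> nat \<Rightarrow> bool"
  have cell: "(i, j * v i) \<in> ray_cells n v" if "j \<in> {1..n div Max (range v)}" for i j v
    unfolding ray_cells_def using that by (intro image_eqI[of _ _ "(i, j)"]) auto
  \<comment> \<open>The ray event is rewritten as a predicate of the cells of its ray only, the form
    in which disjoint blocks give independence.\<close>
  have F: "F v = {\<omega> \<in> space M. f v (restrict (\<lambda>x. X x \<omega>) (ray_cells n v))}" for v
  proof -
    have "f v (restrict (\<lambda>x. X x \<omega>) (ray_cells n v)) \<longleftrightarrow> (\<exists>j\<in>{1..n div Max (range v)}. \<forall>i. j * v i \<in> A i \<omega>)" for \<omega>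
      unfolding f_def by (intro bex_cong refl) (simp add: cell X_def)
    then show ?thesis by (simp add: F_def)
  qed
  have fm: "f v \<in> measurable (PiM (ray_cells n v) (\<lambda>_. count_space UNIV)) (count_space UNIV)" for v
  proof -
    have comp: "(\<lambda>x. x (i, j * v i)) \<in> measurable (PiM (ray_cells n v) (\<lambda>_. count_space (UNIV::bool set))) (count_space UNIV)"
      if "j \<in> {1..n div Max (range v)}" for i j
      by (rule measurable_component_singleton) (rule cell[OF that])
    show ?thesis
      unfolding f_def[abs_def] by (subst ball_UNIV[symmetric]) (intro pred_intros_finite comp finite finite_atLeastAtMost)
  qed
  show int: "prob (F v \<inter> F w) = prob (F v) * prob (F w)"
    if "v \<in> primitive_grid n" "w \<in> primitive_grid n" "ray_cells n v \<inter> ray_cells n w = {}" for v w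
  proof -
    have "F v \<inter> F w = {\<omega> \<in> space M. f v (restrict (\<lambda>x. X x \<omega>) (ray_cells n v)) \<and> f w (restrict (\<lambda>x. X x \<omega>) (ray_cells n w))}"
      by (auto simp: F)
    then show ?thesis
      using prob_conj_disjoint_blocks[OF ind that(3) ray_cells_subset ray_cells_subset fm fm] that
      by (simp add: F)
  qed
  assume v: "v \<in> primitive_grid n"
  define J where "J = {1..n div Max (range v)}"
  define K where "K j = range (\<lambda>i. (i, j * v i))" for j
  have vpos: "v i > 0" for i using v by (auto simp: primitive_grid_def grid_def Pi_iff Suc_le_eq)
  have Xm: "X x \<in> measurable M (count_space UNIV)" if "x \<in> UNIV \<times> {1..n}" for x
    using ind that by (auto simp: indep_vars_def2)
  have "(\<lambda>\<omega>. restrict (\<lambda>x. X x \<omega>) (ray_cells n v)) \<in> measurable M (PiM (ray_cells n v) (\<lambda>_. count_space UNIV))"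
    using ray_cells_subset[OF v] by (intro measurable_restrict Xm) auto
  from measurable_compose[OF this fm]
  show ev: "F v \<in> events" by (simp add: F pred_def)
  have "prob {\<omega> \<in> space M. \<forall>j\<in>J. \<not> (\<forall>x\<in>K j. X x \<omega>)} = (\<Prod>j\<in>J. 1 - (\<Prod>x\<in>K j. prob {\<omega> \<in> space M. X x \<omega>}))"
  proof (rule prob_none_of_blocks[OF ind])
    show "finite J" by (simp add: J_def)
    show "finite (K j) \<and> K j \<noteq> {} \<and> K j \<subseteq> UNIV \<times> {1..n}" if "j \<in> J" for j
      using multiple_in_grid[OF v that[unfolded J_def]] by (auto simp: K_def grid_def Pi_iff)
    \<comment> \<open>A common cell of two blocks forces equal multiples of a positive coordinate of
      \<open>v\<close>, hence equal multipliers.\<close>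
    show "disjoint_family_on K J"
      using vpos by (auto simp: disjoint_family_on_def K_def) (metis less_numeral_extra(3))
  qed
  also have "\<dots> = (\<Prod>j\<in>J. 1 - (\<Prod>i\<in>UNIV. \<alpha> i))"
  proof (intro prod.cong refl arg_cong2[where f = "(-)"])
    fix j assume "j \<in> J"
    then have jv: "j * v i \<in> {1..n}" for i
      using multiple_in_grid[OF v] by (auto simp: J_def grid_def Pi_iff)
    have "(\<Prod>x\<in>K j. prob {\<omega> \<in> space M. X x \<omega>}) = (\<Prod>i\<in>UNIV. prob {\<omega> \<in> space M. X (i, j * v i) \<omega>})"
      unfolding K_def by (subst prod.reindex) (auto simp: inj_def)
    then show "(\<Prod>x\<in>K j. prob {\<omega> \<in> space M. X x \<omega>}) = (\<Prod>i\<in>UNIV. \<alpha> i)"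
      by (simp add: X_def al[OF jv])
  qed
  also have "{\<omega> \<in> space M. \<forall>j\<in>J. \<not> (\<forall>x\<in>K j. X x \<omega>)} = space M - F v"
    by (auto simp: F_def J_def K_def X_def)
  finally show "prob (F v) = 1 - (1 - (\<Prod>i\<in>UNIV. \<alpha> i)) ^ (n div Max (range v))"
    using ev by (simp add: prob_compl J_def)
qed

text \<open>The visible count is the sum of the ray indicators, and \<open>E\<close> is its mean.
  With at most \<open>d * n ^ (2 * d - 1)\<close> dependent pairs, Chebyshev's inequality at
  distance \<open>\<delta> * n ^ d\<close> leaves a bound of order \<open>1 / n\<close>.
  Measurability is recorded as well, for a later comparison of events.\<close>

lemma prob_visible_deviation_le:
  fixes A :: "'d::finite \<Rightarrow> 'a \<Rightarrow> nat set" and \<alpha> :: "'d \<Rightarrow> real"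
  assumes iv: "indep_vars (\<lambda>i. count_space (Pow {1..n})) A UNIV"
    and ie: "\<And>i. indep_events (\<lambda>m. {\<omega> \<in> space M. m \<in> A i \<omega>}) {1..n}"
    and al: "\<And>i m. m \<in> {1..n} \<Longrightarrow> prob {\<omega> \<in> space M. m \<in> A i \<omega>} = \<alpha> i"
    and n: "n > 0" and \<delta>: "\<delta> > 0"
  defines "E \<equiv> \<Sum>v\<in>(primitive_grid n :: ('d \<Rightarrow> nat) set). 1 - (1 - (\<Prod>i\<in>UNIV. \<alpha> i)) ^ (n div Max (range v))"
  shows "{\<omega> \<in> space M. \<bar>real (card (visible (lattice_product (\<lambda>i. A i \<omega>)))) - E\<bar> \<ge> \<delta> * real n ^ CARD('d)} \<in> events"
    and "prob {\<omega> \<in> space M. \<bar>real (card (visible (lattice_product (\<lambda>i. A i \<omega>)))) - E\<bar> \<ge> \<delta> * real n ^ CARD('d)}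
      \<le> real CARD('d) / \<delta>\<^sup>2 * (1 / real n)"
proof -
  define F where "F v = {\<omega> \<in> space M. \<exists>j\<in>{1..n div Max (range v)}. \<forall>i. j * v i \<in> A i \<omega>}" for v
  let ?R = "primitive_grid n :: ('d \<Rightarrow> nat) set"
  let ?a = "\<delta> * real n ^ CARD('d)"
  let ?D = "{(v, w). ray_cells n v \<inter> ray_cells n w \<noteq> {}} :: (('d \<Rightarrow> nat) \<times> ('d \<Rightarrow> nat)) set"
  have ray: "F v \<in> events" "prob (F v) = 1 - (1 - (\<Prod>i\<in>UNIV. \<alpha> i)) ^ (n div Max (range v))"
    if "v \<in> ?R" for v
    unfolding F_def by (rule ray_event[OF iv ie _ that] prob_ray_event[OF iv ie _ that], rule al, assumption)+
  have rayI: "prob (F v \<inter> F w) = prob (F v) * prob (F w)"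
    if "v \<in> ?R" "w \<in> ?R" "ray_cells n v \<inter> ray_cells n w = {}" for v w
    unfolding F_def by (rule prob_ray_events_Int[OF iv ie _ that]) (rule al)
  have A: "A i \<omega> \<subseteq> {1..n}" if "\<omega> \<in> space M" for i \<omega>
    using iv that measurable_space[of "A i" M "count_space (Pow {1..n})" \<omega>] by (auto simp: indep_vars_def2)
  have V: "real (card (visible (lattice_product (\<lambda>i. A i \<omega>)))) = (\<Sum>v\<in>?R. indicator (F v) \<omega>)"
    if w: "\<omega> \<in> space M" for \<omega>
  proof -
    have "(\<Sum>v\<in>?R. indicator (F v) \<omega> :: real) = card {v \<in> ?R. \<omega> \<in> F v}"
      by (simp add: indicator_def sum.If_cases Int_def)
    then show ?thesis
      unfolding card_visible_lattice_product[OF A[OF w]] using w by (simp add: F_def)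
  qed
  have eq: "{\<omega> \<in> space M. \<bar>real (card (visible (lattice_product (\<lambda>i. A i \<omega>)))) - E\<bar> \<ge> ?a}
    = {\<omega> \<in> space M. \<bar>(\<Sum>v\<in>?R. indicator (F v) \<omega>) - (\<Sum>v\<in>?R. prob (F v))\<bar> \<ge> ?a}"
  proof -
    have "(\<Sum>v\<in>?R. prob (F v)) = E"
      unfolding E_def by (intro sum.cong refl ray(2))
    then show ?thesis using V by auto
  qed
  show "{\<omega> \<in> space M. \<bar>real (card (visible (lattice_product (\<lambda>i. A i \<omega>)))) - E\<bar> \<ge> ?a} \<in> events"
  proof -
    have [measurable]: "F v \<in> events" if "v \<in> ?R" for v using ray(1) that .
    show ?thesis unfolding eq by measurable
  qed
  have apos: "?a > 0" using n \<delta> by simp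
  have "prob {\<omega> \<in> space M. \<bar>real (card (visible (lattice_product (\<lambda>i. A i \<omega>)))) - E\<bar> \<ge> ?a}
      \<le> card (?D \<inter> ?R \<times> ?R) / ?a\<^sup>2"
    unfolding eq
    by (rule prob_sum_indicator_deviation_le[OF finite_primitive_grid ray(1) _ apos]) (use rayI in auto)
  also have "\<dots> \<le> real (CARD('d) * (n ^ CARD('d) * n ^ (CARD('d) - 1))) / ?a\<^sup>2"
    using card_intersecting_rays_le[of n, where 'd='d] by (intro divide_right_mono) (auto simp only: of_nat_le_iff zero_le_power2)
  also have "\<dots> = real CARD('d) / \<delta>\<^sup>2 * (1 / real n)"
  proof -
    have "real n ^ CARD('d) = real n * real n ^ (CARD('d) - 1)"
      by (simp flip: power_Suc)
    then show ?thesis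
      using n \<delta> by (simp add: power2_eq_square field_simps)
  qed
  finally show "prob {\<omega> \<in> space M. \<bar>real (card (visible (lattice_product (\<lambda>i. A i \<omega>)))) - E\<bar> \<ge> ?a}
      \<le> real CARD('d) / \<delta>\<^sup>2 * (1 / real n)" .
qed

end

section \<open>Convergence in probability to the visible density\<close>

theorem theorem1p5:
  fixes \<alpha> :: "'d::finite \<Rightarrow> real"
    and M :: "nat \<Rightarrow> 'w measure"
    and A :: "nat \<Rightarrow> 'd \<Rightarrow> 'w \<Rightarrow> nat set"
  assumes "CARD('d) \<ge> 2"
    and "\<And>i. 0 < \<alpha> i \<and> \<alpha> i < 1"
    and "\<And>n. prob_space (M n)"
    and "\<And>n. prob_space.indep_vars (M n) (\<lambda>i. count_space (Pow {1..n})) (A n) UNIV"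
    and "\<And>n i. prob_space.indep_events (M n) (\<lambda>m. {\<omega> \<in> space (M n). m \<in> A n i \<omega>}) {1..n}"
    and "\<And>n i m. m \<in> {1..n} \<Longrightarrow>
           measure (M n) {\<omega> \<in> space (M n). m \<in> A n i \<omega>} = \<alpha> i"
  shows "\<forall>\<epsilon>>0. (\<lambda>n. measure (M n) {\<omega> \<in> space (M n).
           \<bar>real (card (visible (lattice_product (\<lambda>i. A n i \<omega>))))
              / (visible_density \<alpha> * real n ^ CARD('d)) - 1\<bar> > \<epsilon>}) \<longlonglongrightarrow> 0"
proof (intro allI impI)
  fix \<epsilon> :: real assume \<epsilon>: "\<epsilon> > 0"
  define p where "p = (\<Prod>i\<in>UNIV. \<alpha> i)"
  define \<mu> where "\<mu> = visible_density \<alpha>"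
  define E where "E n = (\<Sum>v\<in>(primitive_grid n :: ('d \<Rightarrow> nat) set). 1 - (1 - p) ^ (n div Max (range v)))" for n
  have "p > 0" unfolding p_def using assms(2) by (intro prod_pos) auto
  moreover have "p < 1"
  proof -
    \<comment> \<open>One factor, at an arbitrary index, supplies strictness; the others are only
      bounded by 1.\<close>
    have "p = \<alpha> undefined * (\<Prod>i\<in>UNIV - {undefined}. \<alpha> i)"
      unfolding p_def by (rule prod.remove) auto
    also have "\<dots> \<le> \<alpha> undefined * 1"
      using assms(2) by (intro mult_left_mono prod_le_1) (auto simp: less_imp_le)
    finally show ?thesis using assms(2)[of undefined] by simp
  qed
  ultimately have p: "0 < p" "p < 1" by auto
  have \<mu>: "\<mu> = p / zeta_nat CARD('d) * (polylog CARD('d) (1 - p) / (1 - p))"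
    by (simp add: \<mu>_def visible_density_def p_def)
  then have \<mu>pos: "\<mu> > 0"
    using p zeta_nat_pos[OF assms(1)] polylog_pos[OF assms(1), of "1 - p"] by simp
  have lim: "(\<lambda>n. E n / real n ^ CARD('d)) \<longlonglongrightarrow> \<mu>"
    unfolding E_def \<mu> by (rule sum_primitive_grid_geometric_tendsto[OF assms(1) p])
  \<comment> \<open>The tolerance \<open>\<epsilon> * \<mu>\<close> is halved: one part for the
    distance of the normalised mean from \<open>\<mu>\<close>, the other for the deviation of the
    count from its mean.\<close>
  define \<delta> where "\<delta> = \<epsilon> * \<mu> / 2"
  have \<delta>: "\<delta> > 0" using \<epsilon> \<mu>pos by (simp add: \<delta>_def)
  let ?V = "\<lambda>n \<omega>. real (card (visible (lattice_product (\<lambda>i. A n i \<omega>))))"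
  let ?P = "\<lambda>n. measure (M n) {\<omega> \<in> space (M n). \<bar>?V n \<omega> / (\<mu> * real n ^ CARD('d)) - 1\<bar> > \<epsilon>}"
  have upper: "\<forall>\<^sub>F n in sequentially. ?P n \<le> real CARD('d) / \<delta>\<^sup>2 * (1 / real n)"
    using tendstoD[OF lim \<delta>] eventually_gt_at_top[of 0]
  proof eventually_elim
    case (elim n)
    interpret prob_space "M n" by (rule assms(3))
    let ?N = "real n ^ CARD('d)"
    have N: "?N > 0" using elim by simp
    let ?S = "{\<omega> \<in> space (M n). \<bar>?V n \<omega> - E n\<bar> \<ge> \<delta> * ?N}"
    have dev: "?S \<in> events" "prob ?S \<le> real CARD('d) / \<delta>\<^sup>2 * (1 / real n)"
      unfolding E_def p_def
      by (rule prob_visible_deviation_le[OF assms(4) assms(5) _ elim(2) \<delta>], rule assms(6), assumption)+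
    have "\<bar>?V n \<omega> - E n\<bar> \<ge> \<delta> * ?N" if "\<bar>?V n \<omega> / (\<mu> * ?N) - 1\<bar> > \<epsilon>" for \<omega>
    proof -
      have "(?V n \<omega> / (\<mu> * ?N) - 1) * \<mu> = ?V n \<omega> / ?N - \<mu>"
        using \<mu>pos by (simp add: left_diff_distrib)
      then have "\<bar>?V n \<omega> / (\<mu> * ?N) - 1\<bar> * \<mu> = \<bar>?V n \<omega> / ?N - \<mu>\<bar>"
        using \<mu>pos by (metis abs_mult abs_of_pos)
      then have "\<bar>?V n \<omega> / ?N - \<mu>\<bar> > \<epsilon> * \<mu>"
        using that \<mu>pos by (metis mult_strict_right_mono)
      then have "\<bar>?V n \<omega> / ?N - E n / ?N\<bar> > \<delta>"
        using elim(1) unfolding dist_real_def \<delta>_def by linarith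
      then have "\<bar>?V n \<omega> - E n\<bar> / ?N > \<delta>"
        using N by (simp add: abs_divide flip: diff_divide_distrib)
      then show ?thesis using N by (simp add: field_simps)
    qed
    \<comment> \<open>Monotonicity of the measure asks for measurability of the larger event,
      supplied by \<open>dev(1)\<close>.\<close>
    then have "?P n \<le> prob ?S"
      by (intro finite_measure_mono dev(1)) auto
    also note dev(2)
    finally show ?case .
  qed
  have "(\<lambda>n. real CARD('d) / \<delta>\<^sup>2 * (1 / real n)) \<longlonglongrightarrow> real CARD('d) / \<delta>\<^sup>2 * 0"
    by (intro tendsto_mult tendsto_const lim_1_over_n)
  then have null: "(\<lambda>n. real CARD('d) / \<delta>\<^sup>2 * (1 / real n)) \<longlonglongrightarrow> 0" by simp
  have "?P \<longlonglongrightarrow> 0"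
    by (rule real_tendsto_sandwich[OF always_eventually upper tendsto_const null]) simp
  then show "(\<lambda>n. measure (M n) {\<omega> \<in> space (M n).
           \<bar>?V n \<omega> / (visible_density \<alpha> * real n ^ CARD('d)) - 1\<bar> > \<epsilon>}) \<longlonglongrightarrow> 0"
    unfolding \<mu>_def .
qed

end
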